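(* For every integer $k \ge 0$, $|I_k(231)|$ is equal to the number of fountains of coins with exactly $k$ coins.
   Context: A permutation of length $n$ is a word $\pi=\pi_1\cdots\pi_n$ containing each of $1,\dots,n$ exactly once. The sum of permutations $\rho=\rho_1\cdots\rho_n$ and $\tau=\tau_1\cdots\tau_m$ is the permutation $\rho\oplus\tau=\rho_1\cdots\rho_n(n+\tau_1)\cdots(n+\tau_m)$ of length $n+m$. A permutation is decomposable if it equals $\rho\oplus\tau$ for some non-empty permutations $\rho,\tau$; a non-empty permutation that is not decomposable is indecomposable. An inversion of $\pi$ is a pair $(i,j)$ with $i<j$ and $\pi_i>\pi_j$. A permutation $\pi$ contains a permutation (pattern) $\tau=\tau_1\cdots\tau_m$ if there are indices $i_1<\dots<i_m$ such that $\pi_{i_1},\dots,\pi_{i_m}$ is order-isomorphic to $\tau_1,\dots,\tau_m$; otherwise $\pi$ avoids $\tau$. $I_k(\tau_1,\dots,\tau_r)$ denotes the (finite) set of all indecomposable permutations, of any length, with exactly $k$ inversions that avoid all of $\tau_1,\dots,\tau_r$. A fountain of coins is an arrangement of coins in rows such that the bottom row is full (contiguous, without holes) and each coin in a higher row rests on two adjacent coins in the row below. Formally, a fountain with $N\ge 0$ coins in the bottom row is a set $F$ of pairs $(h,p)$ of integers (row $h\ge 0$, position $p$ with $1\le p\le N-h$) such that $(0,p)\in F$ for all $1\le p\le N$, and whenever $(h,p)\in F$ with $h\ge 1$ then $(h-1,p)\in F$ and $(h-1,p+1)\in F$. Its coins are the elements of $F$. The empty fountain ($N=0$) is allowed. 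*)

theory Defs
  imports "HOL-Combinatorics.Multiset_Permutations"
begin

text \<open>Permutations are words with 1-based entries, while the positions in a list are 0-based.\<close>

definition is_perm :: "nat list \<Rightarrow> bool" where
  "is_perm \<pi> \<longleftrightarrow> \<pi> \<in> permutations_of_set {1..length \<pi>}"

definition perm_sum :: "nat list \<Rightarrow> nat list \<Rightarrow> nat list" where
  "perm_sum \<rho> \<tau> = \<rho> @ map (\<lambda>x. length \<rho> + x) \<tau>"

definition decomposable :: "nat list \<Rightarrow> bool" where
  "decomposable \<pi> \<longleftrightarrow>
     (\<exists>\<rho> \<tau>. is_perm \<rho> \<and> is_perm \<tau> \<and> \<rho> \<noteq> [] \<and> \<tau> \<noteq> [] \<and> \<pi> = perm_sum \<rho> \<tau>)"

definition indecomposable :: "nat list \<Rightarrow> bool" where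
  "indecomposable \<pi> \<longleftrightarrow> is_perm \<pi> \<and> \<pi> \<noteq> [] \<and> \<not> decomposable \<pi>"

definition inversions :: "nat list \<Rightarrow> (nat \<times> nat) set" where
  "inversions \<pi> = {(i, j). i < j \<and> j < length \<pi> \<and> \<pi> ! i > \<pi> ! j}"

text \<open>The occurrence of the pattern \<open>\<tau>\<close> is given by the strictly increasing sequence of
  indices \<open>f 0 < f 1 < \<dots>\<close>.\<close>

definition contains_pattern :: "nat list \<Rightarrow> nat list \<Rightarrow> bool" where
  "contains_pattern \<pi> \<tau> \<longleftrightarrow>
     (\<exists>f. strict_mono_on {..<length \<tau>} f \<and> f ` {..<length \<tau>} \<subseteq> {..<length \<pi>} \<and>
          (\<forall>a<length \<tau>. \<forall>b<length \<tau>. \<pi> ! f a < \<pi> ! f b \<longleftrightarrow> \<tau> ! a < \<tau> ! b))"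

definition avoids :: "nat list \<Rightarrow> nat list \<Rightarrow> bool" where
  "avoids \<pi> \<tau> \<longleftrightarrow> \<not> contains_pattern \<pi> \<tau>"

definition indec_avoiders :: "nat \<Rightarrow> nat list set \<Rightarrow> nat list set" where
  "indec_avoiders k T =
     {\<pi>. indecomposable \<pi> \<and> card (inversions \<pi>) = k \<and> (\<forall>\<tau>\<in>T. avoids \<pi> \<tau>)}"

text \<open>A pair \<open>(h, p)\<close> is the coin at position \<open>p\<close> of row \<open>h\<close>. The bound \<open>p \<le> N - h\<close> is
  written additively, as subtraction on \<^typ>\<open>nat\<close> truncates.\<close>

definition fountain_with_base :: "nat \<Rightarrow> (nat \<times> nat) set \<Rightarrow> bool" where
  "fountain_with_base N F \<longleftrightarrow>
     (\<forall>(h, p)\<in>F. 1 \<le> p \<and> p + h \<le> N) \<and>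
     (\<forall>p\<in>{1..N}. (0, p) \<in> F) \<and>
     (\<forall>h p. (Suc h, p) \<in> F \<longrightarrow> (h, p) \<in> F \<and> (h, Suc p) \<in> F)"

text \<open>The bottom row determines \<open>N\<close>, so a fountain is identified with its set of coins.\<close>

definition fountains :: "(nat \<times> nat) set set" where
  "fountains = {F. \<exists>N. fountain_with_base N F}"

end

theory Submission
  imports Defs
begin

text \<open>For a permutation \<open>\<pi>\<close> let \<open>d\<^sub>j\<close> be the number of entries to the left of position \<open>j\<close>
  that are larger than \<open>\<pi>\<^sub>j\<close>. The map \<open>\<pi> \<mapsto> d\<close> (the inversion code) is a bijection from the
  permutations of length \<open>n\<close> to the words with \<open>d\<^sub>j \<le> j\<close>, counting positions from \<open>0\<close>, and the
  inversions of \<open>\<pi>\<close> number \<open>\<Sum>d\<^sub>j\<close>.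

  Avoidance of 231 can be read off the code. If \<open>\<pi>\<^sub>m > \<pi>\<^sub>m\<^sub>+\<^sub>1\<close>, then \<open>d\<^sub>m\<^sub>+\<^sub>1 - d\<^sub>m - 1\<close> counts the
  \<open>i < m\<close> with \<open>\<pi>\<^sub>m\<^sub>+\<^sub>1 < \<pi>\<^sub>i < \<pi>\<^sub>m\<close>, and otherwise \<open>d\<^sub>m\<^sub>+\<^sub>1 \<le> d\<^sub>m\<close>. Moreover every
  occurrence of 231 can be moved until its last two positions are adjacent. So \<open>\<pi>\<close> avoids 231 iff
  \<open>d\<^sub>m\<^sub>+\<^sub>1 \<le> d\<^sub>m + 1\<close> for all \<open>m\<close> (lemma \<open>avoids_231_iff_code_step\<close>). For such \<open>\<pi>\<close>,
  a zero \<open>d\<^sub>j = 0\<close> with \<open>j \<ge> 1\<close> means that \<open>\<pi>\<^sub>j\<close> exceeds everything before it, and then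
  nothing after \<open>j\<close> can lie below an entry before \<open>j\<close>; so \<open>\<pi>\<close> splits as a sum at \<open>j\<close>. Hence a
  non-empty 231-avoiding \<open>\<pi>\<close> is indecomposable iff \<open>d\<^sub>j \<ge> 1\<close> for all \<open>j \<ge> 1\<close>
  (lemma \<open>indecomposable_iff_code_pos\<close>).

  In a fountain, let \<open>d\<^sub>q\<close> be the number of coins \<open>(h, p)\<close> on the diagonal \<open>p + h = q\<close>. A coin
  rests on one coin of its own diagonal and on one of the preceding diagonal. So each diagonal is
  filled from the bottom without gaps, the numbers satisfy \<open>d\<^sub>q\<^sub>+\<^sub>1 \<le> d\<^sub>q + 1\<close> with
  \<open>d\<^sub>0 = 0\<close>, and the full bottom row gives \<open>d\<^sub>q \<ge> 1\<close> for \<open>1 \<le> q \<le> N\<close>. These are the same words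
  (called fountain words below), of length \<open>N + 1\<close>, and again \<open>\<Sum>d\<^sub>q\<close> is the number of coins.\<close>

section \<open>The inversion code of a permutation\<close>

lemma is_perm_iff: "is_perm \<pi> \<longleftrightarrow> set \<pi> = {1..length \<pi>} \<and> distinct \<pi>"
  by (simp add: is_perm_def permutations_of_set_def)

text \<open>The number of inversions whose right position is \<open>j\<close>.\<close>
definition left_larger :: "nat list \<Rightarrow> nat \<Rightarrow> nat" where
  "left_larger \<pi> j = card {i. i < j \<and> \<pi> ! j < \<pi> ! i}"

text \<open>The inversion code \<open>d\<close>, a variant of the Lehmer code that counts larger entries to the left.\<close>
definition inv_code :: "nat list \<Rightarrow> nat list" where
  "inv_code \<pi> = map (left_larger \<pi>) [0..<length \<pi>]"

lemma length_inv_code [simp]: "length (inv_code \<pi>) = length \<pi>"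
  by (simp add: inv_code_def)

lemma nth_inv_code [simp]: "j < length \<pi> \<Longrightarrow> inv_code \<pi> ! j = left_larger \<pi> j"
  by (simp add: inv_code_def)

lemma left_larger_le: "left_larger \<pi> j \<le> j"
  using card_mono[of "{..<j}" "{i. i < j \<and> \<pi> ! j < \<pi> ! i}"]
  by (auto simp: left_larger_def)

lemma card_inversions: "card (inversions \<pi>) = sum_list (inv_code \<pi>)"
proof -
  have "inversions \<pi> = prod.swap ` (SIGMA j:{..<length \<pi>}. {i. i < j \<and> \<pi> ! j < \<pi> ! i})"
    by (auto simp: inversions_def image_iff)
  then have "card (inversions \<pi>) = (\<Sum>j<length \<pi>. left_larger \<pi> j)"
    by (simp add: card_image left_larger_def)
  then show ?thesis
    by (simp add: inv_code_def sum_list_sum_nth atLeast0LessThan)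
qed

text \<open>The possible inversion codes of the permutations of length \<open>n\<close>.\<close>
definition subdiagonal_words :: "nat \<Rightarrow> nat list set" where
  "subdiagonal_words n = {d. length d = n \<and> (\<forall>j<n. d ! j \<le> j)}"

lemma subdiagonal_words_Suc:
  "subdiagonal_words (Suc n) = (\<lambda>(d, c). d @ [c]) ` (subdiagonal_words n \<times> {..n})"
proof (intro set_eqI iffI)
  fix e assume e: "e \<in> subdiagonal_words (Suc n)"
  then have "length e = Suc n" by (simp add: subdiagonal_words_def)
  then obtain d c where dc: "e = d @ [c]" "length d = n" by (metis length_Suc_conv_rev)
  have le: "(d @ [c]) ! j \<le> j" if "j < Suc n" for j
    using e that unfolding dc(1) by (simp add: subdiagonal_words_def)
  have "d ! j \<le> j" if "j < n" for j using le[of j] that dc by (simp add: nth_append)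
  moreover have "c \<le> n" using le[of n] dc by (simp add: nth_append)
  ultimately show "e \<in> (\<lambda>(d, c). d @ [c]) ` (subdiagonal_words n \<times> {..n})"
    using dc by (auto simp: subdiagonal_words_def)
next
  fix e assume "e \<in> (\<lambda>(d, c). d @ [c]) ` (subdiagonal_words n \<times> {..n})"
  then show "e \<in> subdiagonal_words (Suc n)"
    by (auto simp: subdiagonal_words_def nth_append less_Suc_eq)
qed

lemma card_subdiagonal_words: "card (subdiagonal_words n) = fact n"
proof (induction n)
  case 0
  have "subdiagonal_words 0 = {[]}" by (auto simp: subdiagonal_words_def)
  then show ?case by simp
next
  case (Suc n)
  have "inj_on (\<lambda>(d, c). d @ [c]) (subdiagonal_words n \<times> {..n})"
    by (auto simp: inj_on_def)
  then show ?case
    by (simp add: subdiagonal_words_Suc card_image card_cartesian_product Suc)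
qed

text \<open>Appending the value \<open>v\<close> and shifting the entries that are at least \<open>v\<close> out of its way.\<close>
definition append_value :: "nat list \<Rightarrow> nat \<Rightarrow> nat list" where
  "append_value \<rho> v = map (\<lambda>x. if v \<le> x then Suc x else x) \<rho> @ [v]"

lemma is_perm_append_value:
  assumes "is_perm \<rho>" "1 \<le> v" "v \<le> Suc (length \<rho>)"
  shows "is_perm (append_value \<rho> v)"
proof -
  let ?f = "\<lambda>x. if v \<le> x then Suc x else x"
  have inj: "inj_on ?f A" for A by (auto simp: inj_on_def split: if_splits)
  have dist: "distinct (append_value \<rho> v)"
    using assms inj[of "set \<rho>"] by (auto simp: append_value_def is_perm_iff distinct_map)
  have "set (append_value \<rho> v) \<subseteq> {1..Suc (length \<rho>)}"
    using assms by (auto simp: append_value_def is_perm_iff)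
  moreover have "card (set (append_value \<rho> v)) = Suc (length \<rho>)"
    using distinct_card[OF dist] by (simp add: append_value_def)
  ultimately have "set (append_value \<rho> v) = {1..Suc (length \<rho>)}"
    by (intro card_subset_eq) auto
  then show ?thesis using dist by (simp add: is_perm_iff) (simp add: append_value_def)
qed

lemma inv_code_append_value:
  assumes "is_perm \<rho>" "1 \<le> v" "v \<le> Suc (length \<rho>)"
  shows "inv_code (append_value \<rho> v) = inv_code \<rho> @ [Suc (length \<rho>) - v]"
proof (rule nth_equalityI)
  show "length (inv_code (append_value \<rho> v)) = length (inv_code \<rho> @ [Suc (length \<rho>) - v])"
    by (simp add: append_value_def)
next
  fix j assume "j < length (inv_code (append_value \<rho> v))"
  then have j: "j \<le> length \<rho>" by (simp add: append_value_def)
  let ?\<pi> = "append_value \<rho> v"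
  show "inv_code ?\<pi> ! j = (inv_code \<rho> @ [Suc (length \<rho>) - v]) ! j"
  proof (cases "j = length \<rho>")
    case True
    have "{i. i < j \<and> ?\<pi> ! j < ?\<pi> ! i} = {i. i < length \<rho> \<and> v \<le> \<rho> ! i}"
      by (auto simp: append_value_def nth_append True)
    moreover have "bij_betw ((!) \<rho>) {i. i < length \<rho> \<and> v \<le> \<rho> ! i} {v..length \<rho>}"
    proof (rule bij_betw_imageI)
      show "inj_on ((!) \<rho>) {i. i < length \<rho> \<and> v \<le> \<rho> ! i}"
        using assms by (auto simp: inj_on_def is_perm_iff nth_eq_iff_index_eq)
      have "x \<in> {v..length \<rho>} \<longleftrightarrow> x \<in> set \<rho> \<and> v \<le> x" for x
        using assms by (auto simp: is_perm_iff)
      then show "(!) \<rho> ` {i. i < length \<rho> \<and> v \<le> \<rho> ! i} = {v..length \<rho>}"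
        by (auto simp only: in_set_conv_nth set_eq_iff image_iff mem_Collect_eq)
    qed
    ultimately have "left_larger ?\<pi> j = Suc (length \<rho>) - v"
      by (simp add: left_larger_def bij_betw_same_card)
    then show ?thesis by (simp add: True nth_append append_value_def)
  next
    case False
    have "{i. i < j \<and> ?\<pi> ! j < ?\<pi> ! i} = {i. i < j \<and> \<rho> ! j < \<rho> ! i}"
      using False j by (auto simp: append_value_def nth_append)
    then have "left_larger ?\<pi> j = left_larger \<rho> j" by (simp add: left_larger_def)
    then show ?thesis using False j by (simp add: nth_append append_value_def)
  qed
qed

lemma ex_perm_inv_code:
  assumes "d \<in> subdiagonal_words n"
  shows "\<exists>\<pi>. is_perm \<pi> \<and> length \<pi> = n \<and> inv_code \<pi> = d"
  using assms
proof (induction n arbitrary: d)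
  case 0
  then show ?case by (auto simp: subdiagonal_words_def is_perm_iff inv_code_def)
next
  case (Suc n)
  from Suc.prems obtain e c where d: "d = e @ [c]" "e \<in> subdiagonal_words n" "c \<le> n"
    by (auto simp: subdiagonal_words_Suc)
  with Suc.IH obtain \<rho> where \<rho>: "is_perm \<rho>" "length \<rho> = n" "inv_code \<rho> = e" by blast
  let ?\<pi> = "append_value \<rho> (Suc n - c)"
  have "is_perm ?\<pi>" "inv_code ?\<pi> = d"
    using \<rho> d is_perm_append_value[of \<rho> "Suc n - c"] inv_code_append_value[of \<rho> "Suc n - c"]
    by auto
  moreover have "length ?\<pi> = Suc n" using \<rho> by (simp add: append_value_def)
  ultimately show ?case by blast
qed

text \<open>Surjectivity is constructive; injectivity follows because both sides have \<open>n!\<close> elements.\<close>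
lemma bij_betw_inv_code_length:
  "bij_betw inv_code {\<pi>. is_perm \<pi> \<and> length \<pi> = n} (subdiagonal_words n)"
proof -
  let ?P = "{\<pi>. is_perm \<pi> \<and> length \<pi> = n}"
  have P: "?P = permutations_of_set {1..n}"
    by (auto simp: is_perm_def length_finite_permutations_of_set)
  have img: "inv_code ` ?P = subdiagonal_words n"
  proof
    show "inv_code ` ?P \<subseteq> subdiagonal_words n"
      by (auto simp: subdiagonal_words_def left_larger_le)
    show "subdiagonal_words n \<subseteq> inv_code ` ?P"
      using ex_perm_inv_code by fastforce
  qed
  have "card ?P = fact n" unfolding P by simp
  moreover have "finite ?P" unfolding P by simp
  ultimately have "inj_on inv_code ?P"
    by (intro eq_card_imp_inj_on) (simp_all add: img card_subdiagonal_words)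
  with img show ?thesis by (simp add: bij_betw_def)
qed

lemma bij_betw_inv_code:
  "bij_betw inv_code {\<pi>. is_perm \<pi>} {d. \<forall>j<length d. d ! j \<le> j}"
proof (rule bij_betw_imageI)
  show "inj_on inv_code {\<pi>. is_perm \<pi>}"
  proof (rule inj_onI)
    fix \<pi> \<sigma> assume *: "\<pi> \<in> {\<pi>. is_perm \<pi>}" "\<sigma> \<in> {\<pi>. is_perm \<pi>}" "inv_code \<pi> = inv_code \<sigma>"
    then have "length \<sigma> = length \<pi>" by (metis length_inv_code)
    then show "\<pi> = \<sigma>"
      using * bij_betw_imp_inj_on[OF bij_betw_inv_code_length[of "length \<pi>"]]
      by (auto dest: inj_onD)
  qed
  have "d \<in> inv_code ` {\<pi>. is_perm \<pi>}" if "\<forall>j<length d. d ! j \<le> j" for d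
    using ex_perm_inv_code[of d "length d"] that by (auto simp: subdiagonal_words_def)
  then show "inv_code ` {\<pi>. is_perm \<pi>} = {d. \<forall>j<length d. d ! j \<le> j}"
    by (auto simp: left_larger_le)
qed

section \<open>Avoidance of 231 and indecomposability in terms of the code\<close>

lemma contains_231_iff:
  "contains_pattern \<pi> [2, 3, 1] \<longleftrightarrow>
     (\<exists>i j l. i < j \<and> j < l \<and> l < length \<pi> \<and> \<pi> ! l < \<pi> ! i \<and> \<pi> ! i < \<pi> ! j)"
proof
  assume "contains_pattern \<pi> [2, 3, 1]"
  then obtain f where f: "strict_mono_on {..<3::nat} f" "f ` {..<3} \<subseteq> {..<length \<pi>}"
    and o: "\<And>a b. a < 3 \<Longrightarrow> b < 3 \<Longrightarrow>
      \<pi> ! f a < \<pi> ! f b \<longleftrightarrow> [2, 3, 1::nat] ! a < [2, 3, 1] ! b"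
    unfolding contains_pattern_def by (auto simp: numeral_3_eq_3)
  have "f 0 < f 1" "f 1 < f 2" using f(1) by (auto simp: strict_mono_on_def)
  moreover have "f 2 < length \<pi>" using f(2) by (force simp: image_subset_iff)
  moreover have "\<pi> ! f 2 < \<pi> ! f 0" "\<pi> ! f 0 < \<pi> ! f 1"
    using o[of 2 0] o[of 0 1] by auto
  ultimately show "\<exists>i j l. i < j \<and> j < l \<and> l < length \<pi> \<and> \<pi> ! l < \<pi> ! i \<and> \<pi> ! i < \<pi> ! j"
    by blast
next
  assume "\<exists>i j l. i < j \<and> j < l \<and> l < length \<pi> \<and> \<pi> ! l < \<pi> ! i \<and> \<pi> ! i < \<pi> ! j"
  then obtain i j l where *: "i < j" "j < l" "l < length \<pi>" "\<pi> ! l < \<pi> ! i" "\<pi> ! i < \<pi> ! j"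
    by blast
  define f where "f a = [i, j, l] ! a" for a
  have three: "{..<length [2, 3, 1::nat]} = {0, 1, 2}" by auto
  have all3: "(\<forall>a<length [2, 3, 1::nat]. P a) \<longleftrightarrow> P 0 \<and> P 1 \<and> P 2" for P :: "nat \<Rightarrow> bool"
    by (auto simp: less_Suc_eq numeral_2_eq_2)
  show "contains_pattern \<pi> [2, 3, 1]"
    unfolding contains_pattern_def
  proof (intro exI[of _ f] conjI)
    show "strict_mono_on {..<length [2, 3, 1::nat]} f"
      unfolding three using * by (auto simp: strict_mono_on_def f_def)
    show "f ` {..<length [2, 3, 1::nat]} \<subseteq> {..<length \<pi>}"
      unfolding three using * by (auto simp: f_def)
    show "\<forall>a<length [2, 3, 1::nat]. \<forall>b<length [2, 3, 1::nat].
        (\<pi> ! f a < \<pi> ! f b) = ([2, 3, 1::nat] ! a < [2, 3, 1] ! b)"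
      unfolding all3 using * by (auto simp: f_def)
  qed
qed

text \<open>The entry after the largest one of an occurrence of 231 can serve either as the new smallest
  entry or as the new largest entry.\<close>
lemma contains_231_adjacent:
  fixes \<pi> :: "'a :: linorder list"
  assumes "distinct \<pi>" "i < j" "j < l" "l < length \<pi>" "\<pi> ! l < \<pi> ! i" "\<pi> ! i < \<pi> ! j"
  shows "\<exists>i m. i < m \<and> Suc m < length \<pi> \<and> \<pi> ! Suc m < \<pi> ! i \<and> \<pi> ! i < \<pi> ! m"
  using assms
proof (induction "l - j" arbitrary: j rule: less_induct)
  case less
  show ?case
  proof (cases "\<pi> ! Suc j < \<pi> ! i")
    case True
    then show ?thesis using less.prems by (intro exI[of _ i] exI[of _ j]) auto
  next
    case False
    moreover have "\<pi> ! i \<noteq> \<pi> ! Suc j"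
      using less.prems by (simp add: nth_eq_iff_index_eq)
    ultimately have "\<pi> ! i < \<pi> ! Suc j" by simp
    moreover from False less.prems have "Suc j < l" by (metis Suc_lessI)
    ultimately show ?thesis using less.prems by (intro less.hyps[of "Suc j"]) auto
  qed
qed

text \<open>An entry \<open>\<pi>\<^sub>i\<close> with \<open>\<pi>\<^sub>m\<^sub>+\<^sub>1 < \<pi>\<^sub>i < \<pi>\<^sub>m\<close> and \<open>i < m\<close> is exactly what makes the code
  grow by more than one at a descent; at an ascent the code does not grow.\<close>
lemma avoids_231_iff_code_step:
  assumes "is_perm \<pi>"
  shows "avoids \<pi> [2, 3, 1] \<longleftrightarrow>
    (\<forall>m. Suc m < length \<pi> \<longrightarrow> left_larger \<pi> (Suc m) \<le> Suc (left_larger \<pi> m))"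
proof
  assume av: "avoids \<pi> [2, 3, 1]"
  show "\<forall>m. Suc m < length \<pi> \<longrightarrow> left_larger \<pi> (Suc m) \<le> Suc (left_larger \<pi> m)"
  proof (intro allI impI)
    fix m assume m: "Suc m < length \<pi>"
    have "{i. i < Suc m \<and> \<pi> ! Suc m < \<pi> ! i} \<subseteq> insert m {i. i < m \<and> \<pi> ! m < \<pi> ! i}"
    proof
      fix i assume i: "i \<in> {i. i < Suc m \<and> \<pi> ! Suc m < \<pi> ! i}"
      show "i \<in> insert m {i. i < m \<and> \<pi> ! m < \<pi> ! i}"
      proof (cases "i = m")
        case False
        then have "i < m" using i by simp
        moreover have "\<pi> ! i \<noteq> \<pi> ! m"
          using assms m \<open>i < m\<close> by (simp add: is_perm_iff nth_eq_iff_index_eq)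
        moreover have "\<not> \<pi> ! i < \<pi> ! m"
          using av i m \<open>i < m\<close> unfolding avoids_def contains_231_iff by blast
        ultimately show ?thesis by simp
      qed simp
    qed
    then have "left_larger \<pi> (Suc m) \<le> card (insert m {i. i < m \<and> \<pi> ! m < \<pi> ! i})"
      unfolding left_larger_def by (intro card_mono) auto
    then show "left_larger \<pi> (Suc m) \<le> Suc (left_larger \<pi> m)"
      by (simp add: left_larger_def)
  qed
next
  assume step: "\<forall>m. Suc m < length \<pi> \<longrightarrow> left_larger \<pi> (Suc m) \<le> Suc (left_larger \<pi> m)"
  show "avoids \<pi> [2, 3, 1]"
    unfolding avoids_def
  proof
    assume "contains_pattern \<pi> [2, 3, 1]"
    then obtain i m where *: "i < m" "Suc m < length \<pi>" "\<pi> ! Suc m < \<pi> ! i" "\<pi> ! i < \<pi> ! m"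
      using contains_231_adjacent assms unfolding contains_231_iff is_perm_iff by metis
    have "card (insert i (insert m {i. i < m \<and> \<pi> ! m < \<pi> ! i})) \<le> left_larger \<pi> (Suc m)"
      unfolding left_larger_def using * by (intro card_mono) auto
    moreover have "card (insert i (insert m {i. i < m \<and> \<pi> ! m < \<pi> ! i}))
        = Suc (Suc (left_larger \<pi> m))"
      using * by (simp add: left_larger_def)
    ultimately show False using step * by fastforce
  qed
qed

lemma down_closed_eq_lessThan:
  fixes A :: "nat set"
  assumes "finite A" "\<And>x y. x \<in> A \<Longrightarrow> y < x \<Longrightarrow> y \<in> A"
  shows "A = {..<card A}"
proof -
  have "A \<subseteq> {..<card A}"
  proof
    fix x assume "x \<in> A"
    then have "{..x} \<subseteq> A" using assms(2) by (auto simp: le_less)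
    then have "card {..x} \<le> card A" by (rule card_mono[OF assms(1)])
    then show "x \<in> {..<card A}" by simp
  qed
  then show ?thesis by (intro card_subset_eq) auto
qed

lemma decomposableI:
  assumes \<pi>: "is_perm \<pi>" and j: "0 < j" "j < length \<pi>"
    and less: "\<And>i l. i < j \<Longrightarrow> j \<le> l \<Longrightarrow> l < length \<pi> \<Longrightarrow> \<pi> ! i < \<pi> ! l"
  shows "decomposable \<pi>"
proof -
  have dist: "distinct \<pi>" and set: "set \<pi> = {1..length \<pi>}"
    using \<pi> by (auto simp: is_perm_iff)
  let ?A = "set (take j \<pi>)" and ?B = "set (drop j \<pi>)"
  have un: "?A \<union> ?B = {1..length \<pi>}" by (metis append_take_drop_id set set_append)
  have lt: "x < y" if xy: "x \<in> ?A" "y \<in> ?B" for x y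
  proof -
    obtain i where "i < j" "x = \<pi> ! i" using xy(1) by (auto simp: in_set_conv_nth)
    moreover obtain m where "m < length \<pi> - j" "y = \<pi> ! (j + m)"
      using xy(2) by (auto simp: in_set_conv_nth)
    ultimately show ?thesis using less[of i "j + m"] by simp
  qed
  have cardA: "card ?A = j" using dist j by (simp add: distinct_card)
  have "0 \<notin> ?A" using un by (metis UnI1 atLeastAtMost_iff not_one_le_zero)
  \<comment> \<open>Entries are counted from \<open>1\<close>, so \<open>0\<close> is added to obtain a downward closed set.\<close>
  have "insert 0 ?A = {..<card (insert 0 ?A)}"
  proof (rule down_closed_eq_lessThan)
    fix x y assume xy: "x \<in> insert 0 ?A" "y < x"
    then have "x \<in> ?A" by auto
    then have "x \<in> {1..length \<pi>}" using un by blast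
    then have "y = 0 \<or> y \<in> ?A \<union> ?B" unfolding un using xy(2) by auto
    then show "y \<in> insert 0 ?A" using lt[OF \<open>x \<in> ?A\<close>, of y] xy(2) by auto
  qed simp
  also have "\<dots> = {..j}" using \<open>0 \<notin> ?A\<close> cardA by auto
  finally have "?A = {..j} - {0}"
    using Diff_insert_absorb[OF \<open>0 \<notin> ?A\<close>] by argo
  also have "\<dots> = {1..j}" by auto
  finally have A: "?A = {1..j}" .
  have "?A \<inter> ?B = {}" using dist by (simp add: set_take_disj_set_drop_if_distinct)
  then have "?B = {1..length \<pi>} - {1..j}"
    unfolding A[symmetric] un[symmetric] by (simp add: Un_Diff Diff_triv Int_commute)
  also have "\<dots> = {Suc j..length \<pi>}" by auto
  finally have B: "?B = {Suc j..length \<pi>}" .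
  let ?\<tau> = "map (\<lambda>x. x - j) (drop j \<pi>)"
  have "(\<lambda>x. x - j) ` {Suc j..length \<pi>} = {1..length \<pi> - j}"
  proof (intro equalityI subsetI)
    fix y assume "y \<in> {1..length \<pi> - j}"
    then have "y = (y + j) - j" "y + j \<in> {Suc j..length \<pi>}" by auto
    then show "y \<in> (\<lambda>x. x - j) ` {Suc j..length \<pi>}" by (rule image_eqI)
  qed auto
  then have "set ?\<tau> = {1..length ?\<tau>}" by (simp add: B)
  moreover have "distinct ?\<tau>"
    using dist by (auto simp: distinct_map B inj_on_def)
  ultimately have "is_perm ?\<tau>" by (simp add: is_perm_iff)
  moreover have "is_perm (take j \<pi>)" using A dist j by (simp add: is_perm_iff)
  moreover have "map (\<lambda>x. j + x) ?\<tau> = drop j \<pi>"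
    unfolding map_map by (rule map_idI) (use B in auto)
  then have "\<pi> = perm_sum (take j \<pi>) ?\<tau>"
    using j by (simp add: perm_sum_def del: map_map)
  ultimately show ?thesis
    unfolding decomposable_def using j
    by (intro exI[of _ "take j \<pi>"] exI[of _ ?\<tau>]) auto
qed

lemma indecomposable_iff_code_pos:
  assumes "is_perm \<pi>" "avoids \<pi> [2, 3, 1]"
  shows "indecomposable \<pi> \<longleftrightarrow>
    \<pi> \<noteq> [] \<and> (\<forall>j. 0 < j \<and> j < length \<pi> \<longrightarrow> 0 < left_larger \<pi> j)"
proof (intro iffI conjI allI impI)
  assume "indecomposable \<pi>"
  then show "\<pi> \<noteq> []" by (simp add: indecomposable_def)
next
  fix j assume ind: "indecomposable \<pi>" and j: "0 < j \<and> j < length \<pi>"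
  show "0 < left_larger \<pi> j"
  proof (rule ccontr)
    assume "\<not> 0 < left_larger \<pi> j"
    then have no: "{i. i < j \<and> \<pi> ! j < \<pi> ! i} = {}" by (simp add: left_larger_def)
    have neq: "\<pi> ! i \<noteq> \<pi> ! l" if "i < j" "j \<le> l" "l < length \<pi>" for i l
      using assms(1) that by (simp add: is_perm_iff nth_eq_iff_index_eq)
    have lt: "\<pi> ! i < \<pi> ! j" if "i < j" for i
      using no neq[of i j] that j by force
    have "\<pi> ! i < \<pi> ! l" if "i < j" "j \<le> l" "l < length \<pi>" for i l
    proof (cases "l = j")
      case False
      then have "\<not> \<pi> ! l < \<pi> ! i"
        using assms(2) lt[of i] that unfolding avoids_def contains_231_iff
        by (metis le_neq_implies_less)
      then show ?thesis using neq[of i l] that by linarith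
    qed (use lt that in simp)
    then have "decomposable \<pi>" using assms(1) j by (intro decomposableI[of \<pi> j]) auto
    then show False using ind by (simp add: indecomposable_def)
  qed
next
  assume pos: "\<pi> \<noteq> [] \<and> (\<forall>j. 0 < j \<and> j < length \<pi> \<longrightarrow> 0 < left_larger \<pi> j)"
  have "\<not> decomposable \<pi>"
  proof
    assume "decomposable \<pi>"
    then obtain \<rho> \<tau> where *: "is_perm \<rho>" "\<rho> \<noteq> []" "\<tau> \<noteq> []" "\<pi> = perm_sum \<rho> \<tau>"
      by (auto simp: decomposable_def)
    have "\<rho> ! i \<le> length \<rho>" if "i < length \<rho>" for i
      using *(1) nth_mem[OF that] by (simp add: is_perm_iff)
    then have "{i. i < length \<rho> \<and> \<pi> ! length \<rho> < \<pi> ! i} = {}"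
      using * by (fastforce simp: perm_sum_def nth_append)
    then have "left_larger \<pi> (length \<rho>) = 0" unfolding left_larger_def by (simp only: card.empty)
    moreover have "0 < length \<rho> \<and> length \<rho> < length \<pi>"
      using * by (simp add: perm_sum_def)
    ultimately show False using pos by fastforce
  qed
  then show "indecomposable \<pi>" using pos assms by (simp add: indecomposable_def)
qed

text \<open>The words that encode both kinds of objects. The empty fountain and the permutation of
  length 1 correspond to the word \<open>[0]\<close>.\<close>
definition fountain_words :: "nat list set" where
  "fountain_words = {d. d \<noteq> [] \<and> d ! 0 = 0 \<and> (\<forall>j. 0 < j \<and> j < length d \<longrightarrow> 0 < d ! j) \<and>
     (\<forall>m. Suc m < length d \<longrightarrow> d ! Suc m \<le> Suc (d ! m))}"

lemma fountain_words_le: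
  assumes "d \<in> fountain_words" "j < length d"
  shows "d ! j \<le> j"
  using assms(2)
proof (induction j)
  case 0
  then show ?case using assms(1) by (simp add: fountain_words_def)
next
  case (Suc j)
  then have "d ! Suc j \<le> Suc (d ! j)" using assms(1) by (simp add: fountain_words_def)
  also have "\<dots> \<le> Suc j" using Suc by simp
  finally show ?case .
qed

lemma inv_code_in_fountain_words_iff:
  assumes "is_perm \<pi>"
  shows "inv_code \<pi> \<in> fountain_words \<longleftrightarrow> indecomposable \<pi> \<and> avoids \<pi> [2, 3, 1]"
proof -
  have "inv_code \<pi> ! 0 = 0" if "\<pi> \<noteq> []"
    using that by (simp add: left_larger_def)
  moreover have "inv_code \<pi> = [] \<longleftrightarrow> \<pi> = []" by (simp add: inv_code_def)
  ultimately have "inv_code \<pi> \<in> fountain_words \<longleftrightarrow>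
      \<pi> \<noteq> [] \<and> (\<forall>j. 0 < j \<and> j < length \<pi> \<longrightarrow> 0 < left_larger \<pi> j) \<and> avoids \<pi> [2, 3, 1]"
    unfolding avoids_231_iff_code_step[OF assms] by (auto simp: fountain_words_def)
  then show ?thesis using indecomposable_iff_code_pos[OF assms] by blast
qed

lemma bij_betw_indec_avoiders_fountain_words:
  "bij_betw inv_code (indec_avoiders k {[2, 3, 1]}) {d \<in> fountain_words. sum_list d = k}"
proof (rule bij_betw_subset[OF bij_betw_inv_code])
  show "indec_avoiders k {[2, 3, 1]} \<subseteq> {\<pi>. is_perm \<pi>}"
    by (auto simp: indec_avoiders_def indecomposable_def)
  show "inv_code ` indec_avoiders k {[2, 3, 1]} = {d \<in> fountain_words. sum_list d = k}"
  proof (intro equalityI subsetI)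
    fix d assume "d \<in> inv_code ` indec_avoiders k {[2, 3, 1]}"
    then show "d \<in> {d \<in> fountain_words. sum_list d = k}"
      by (auto simp: indec_avoiders_def indecomposable_def card_inversions
          inv_code_in_fountain_words_iff)
  next
    fix d assume d: "d \<in> {d \<in> fountain_words. sum_list d = k}"
    then have "d \<in> inv_code ` {\<pi>. is_perm \<pi>}"
      using bij_betw_imp_surj_on[OF bij_betw_inv_code] fountain_words_le by blast
    then obtain \<pi> where "is_perm \<pi>" "d = inv_code \<pi>" by auto
    then show "d \<in> inv_code ` indec_avoiders k {[2, 3, 1]}"
      using d by (auto simp: indec_avoiders_def card_inversions inv_code_in_fountain_words_iff)
  qed
qed

section \<open>Fountains and their diagonals\<close>

text \<open>The fountain with the \<open>d\<^sub>q\<close> lowest places of each diagonal \<open>p + h = q\<close> occupied. As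
  \<open>d\<^sub>q \<le> q\<close> for fountain words, the position \<open>p = q - h\<close> is at least \<open>1\<close>.\<close>
definition fountain_of :: "nat list \<Rightarrow> (nat \<times> nat) set" where
  "fountain_of d = {(h, p). p + h < length d \<and> h < d ! (p + h)}"

lemma fountain_of_eq_image:
  assumes "d \<in> fountain_words"
  shows "fountain_of d = (\<lambda>(q, h). (h, q - h)) ` (SIGMA q:{..<length d}. {..<d ! q})"
proof (intro equalityI subsetI)
  fix x assume "x \<in> fountain_of d"
  then show "x \<in> (\<lambda>(q, h). (h, q - h)) ` (SIGMA q:{..<length d}. {..<d ! q})"
    by (auto simp: fountain_of_def intro!: image_eqI[where x = "(snd x + fst x, fst x)"])
next
  fix x assume "x \<in> (\<lambda>(q, h). (h, q - h)) ` (SIGMA q:{..<length d}. {..<d ! q})"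
  then show "x \<in> fountain_of d"
    using fountain_words_le[OF assms] by (fastforce simp: fountain_of_def)
qed

lemma card_fountain_of:
  assumes "d \<in> fountain_words"
  shows "card (fountain_of d) = sum_list d"
proof -
  have "inj_on (\<lambda>(q, h). (h, q - h)) (SIGMA q:{..<length d}. {..<d ! q})"
  proof (rule inj_onI, clarsimp)
    fix q q' h assume "q < length d" "h < d ! q" "q' < length d" "h < d ! q'" "q - h = q' - h"
    then show "q = q'"
      using fountain_words_le[OF assms, of q] fountain_words_le[OF assms, of q'] by linarith
  qed
  then show ?thesis
    by (simp add: fountain_of_eq_image[OF assms] card_image sum_list_sum_nth atLeast0LessThan)
qed

lemma fountain_with_base_fountain_of:
  assumes "d \<in> fountain_words"
  shows "fountain_with_base (length d - 1) (fountain_of d)"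
  unfolding fountain_with_base_def
proof (intro conjI allI impI)
  show "\<forall>(h, p)\<in>fountain_of d. 1 \<le> p \<and> p + h \<le> length d - 1"
    using fountain_words_le[OF assms] by (fastforce simp: fountain_of_def)
  show "\<forall>p\<in>{1..length d - 1}. (0, p) \<in> fountain_of d"
    using assms by (auto simp: fountain_of_def fountain_words_def)
next
  fix h p assume "(Suc h, p) \<in> fountain_of d"
  then have *: "Suc (p + h) < length d" "Suc h < d ! Suc (p + h)"
    by (auto simp: fountain_of_def)
  moreover have "d ! Suc (p + h) \<le> Suc (d ! (p + h))"
    using assms * by (simp add: fountain_words_def)
  ultimately show "(h, p) \<in> fountain_of d" "(h, Suc p) \<in> fountain_of d"
    by (auto simp: fountain_of_def)
qed

text \<open>The length of the word is read off the bottom row, and its letters off the diagonals.\<close>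
lemma inj_on_fountain_of: "inj_on fountain_of fountain_words"
proof (rule inj_onI)
  fix d e assume d: "d \<in> fountain_words" and e: "e \<in> fountain_words"
    and eq: "fountain_of d = fountain_of e"
  have row: "{p. (0, p) \<in> fountain_of d} = {1..<length d}" if "d \<in> fountain_words" for d
    using that by (auto simp: fountain_of_def fountain_words_def Suc_le_eq intro: Nat.gr0I)
  have "length d - 1 = length e - 1"
    using row[OF d] row[OF e] eq by (metis card_atLeastLessThan)
  moreover have "d \<noteq> []" "e \<noteq> []" using d e by (auto simp: fountain_words_def)
  ultimately have len: "length d = length e" by (cases d; cases e) auto
  have diag: "{h. h \<le> q \<and> (h, q - h) \<in> fountain_of d} = {..<d ! q}"
    if "d \<in> fountain_words" "q < length d" for d q
    using that fountain_words_le[OF that] by (auto simp: fountain_of_def)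
  show "d = e"
  proof (rule nth_equalityI[OF len])
    fix q assume "q < length d"
    then show "d ! q = e ! q" using diag[OF d, of q] diag[OF e, of q] eq len by simp
  qed
qed

lemma ex_fountain_word:
  assumes "fountain_with_base N F"
  shows "\<exists>d\<in>fountain_words. fountain_of d = F"
proof -
  have bound: "1 \<le> p" "p + h \<le> N" if "(h, p) \<in> F" for h p
    using assms that by (auto simp: fountain_with_base_def)
  have bottom: "(0, p) \<in> F" if "1 \<le> p" "p \<le> N" for p
    using assms that by (auto simp: fountain_with_base_def)
  have below: "(h, p) \<in> F" "(h, Suc p) \<in> F" if "(Suc h, p) \<in> F" for h p
    using assms that by (auto simp: fountain_with_base_def)
  \<comment> \<open>The rows of the coins on diagonal \<open>q\<close>.\<close>
  define D where "D q = {h. h \<le> q \<and> (h, q - h) \<in> F}" for q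
  have fin: "finite (D q)" for q by (simp add: D_def)
  have desc: "h \<in> D q" if "Suc h \<in> D q" for h q
    using that below(2)[of h "q - Suc h"] by (auto simp: D_def Suc_diff_Suc)
  have down: "y \<in> D q" if "x \<in> D q" "y < x" for x y q
    using that(2,1) by (induction rule: strict_inc_induct) (auto intro: desc)
  have D: "D q = {..<card (D q)}" for q
    using fin down by (rule down_closed_eq_lessThan)
  have mem: "(h, p) \<in> F \<longleftrightarrow> h < card (D (p + h))" for h p
  proof -
    have "(h, p) \<in> F \<longleftrightarrow> h \<in> D (p + h)" by (simp add: D_def)
    then show ?thesis using D[of "p + h"] by blast
  qed
  define d where "d = map (\<lambda>q. card (D q)) [0..<Suc N]"
  have nth: "d ! q = card (D q)" if "q \<le> N" for q
    using that unfolding d_def by (subst nth_map_upt) auto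
  have len: "length d = Suc N" by (simp add: d_def)
  have "d \<in> fountain_words"
    unfolding fountain_words_def
  proof (intro CollectI conjI allI impI)
    show "d \<noteq> []" by (simp add: d_def)
    show "d ! 0 = 0" using mem[of 0 0] bound(1)[of 0 0] nth[of 0] by auto
  next
    fix j assume "0 < j \<and> j < length d"
    then show "0 < d ! j" using bottom[of j] mem[of 0 j] nth[of j] len by auto
  next
    fix m assume "Suc m < length d"
    then have m: "Suc m \<le> N" by (simp add: len)
    show "d ! Suc m \<le> Suc (d ! m)"
    proof (rule ccontr)
      assume "\<not> d ! Suc m \<le> Suc (d ! m)"
      then have less: "Suc (card (D m)) < card (D (Suc m))" using m nth by simp
      \<comment> \<open>The place just above the topmost coin of diagonal \<open>m\<close> would carry a coin.\<close>
      let ?h = "card (D m)"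
      have "Suc ?h \<in> D (Suc m)" using less D[of "Suc m"] by blast
      then have "?h \<le> m" "(Suc ?h, m - ?h) \<in> F" by (auto simp: D_def)
      then have "(?h, m - ?h) \<in> F" using below(1) by blast
      then have "?h < card (D (m - ?h + ?h))" by (simp only: mem)
      then show False using \<open>?h \<le> m\<close> by simp
    qed
  qed
  moreover have "fountain_of d = F"
    using bound(2) mem nth by (fastforce simp: fountain_of_def len)
  ultimately show ?thesis by blast
qed

lemma bij_betw_fountain_words_fountains:
  "bij_betw fountain_of {d \<in> fountain_words. sum_list d = k} {F \<in> fountains. card F = k}"
proof (rule bij_betw_imageI)
  show "inj_on fountain_of {d \<in> fountain_words. sum_list d = k}"
    using inj_on_fountain_of by (rule inj_on_subset) auto
  show "fountain_of ` {d \<in> fountain_words. sum_list d = k} = {F \<in> fountains. card F = k}"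
  proof (intro equalityI subsetI)
    fix F assume "F \<in> fountain_of ` {d \<in> fountain_words. sum_list d = k}"
    then show "F \<in> {F \<in> fountains. card F = k}"
      using fountain_with_base_fountain_of card_fountain_of by (auto simp: fountains_def)
  next
    fix F assume F: "F \<in> {F \<in> fountains. card F = k}"
    then obtain N where "fountain_with_base N F" by (auto simp: fountains_def)
    then obtain d where d: "d \<in> fountain_words" "fountain_of d = F"
      using ex_fountain_word by blast
    then have "sum_list d = k" using F card_fountain_of[of d] by simp
    with d show "F \<in> fountain_of ` {d \<in> fountain_words. sum_list d = k}" by blast
  qed
qed

theorem theorem4:
  fixes k :: nat
  shows "card (indec_avoiders k {[2, 3, 1]}) = card {F \<in> fountains. card F = k}"
  using bij_betw_trans[OF bij_betw_indec_avoiders_fountain_words bij_betw_fountain_words_fountains]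
  by (rule bij_betw_same_card)

end
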